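(* Let $0\le a\le 1$. The equivalence class of the circular Fréchet–Hoeffding copula lower bound is given by $$W_a(u,v)=\begin{cases}\max(u+v-a,0) & (u,v)\in[0,a]^2,\\ \max(u+v-1,a) & (u,v)\in[a,1]^2,\\ \min(u,v) & \text{otherwise.}\end{cases}$$ Here the equivalence class of the circular Fréchet–Hoeffding copula lower bound means the equivalence class $\{C_{\alpha,\beta} : (\alpha,\beta)\in[0,2\pi)^2\}$ of circular copula functions of $H(\theta,\phi)=W(F(\theta),G(\phi))=\max(F(\theta)+G(\phi)-1,0)$, where $F,G$ are circular distribution functions and $W(u,v)=\max(u+v-1,0)$ is the Fréchet–Hoeffding lower bound.
   Context: Write $\mathbf I=[0,1]$ and $\mathbf C=[0,2\pi)$. A circular distribution function is a function $F$ with domain $\mathbf C$ such that $F$ is nondecreasing, $F(0)=0$ and $\lim_{\theta\nearrow2\pi}F(\theta)=1$. The quasi-inverse of a circular distribution function $F$ is the function $F^{(-1)}$ with domain $\mathbf I$ given by $F^{(-1)}(u)=\inf\{\theta : F(\theta)\ge u\}$. A circular joint distribution function is a function $H$ with domain $\mathbf C^2$ such that $H(\theta_2,\phi_2)-H(\theta_2,\phi_1)-H(\theta_1,\phi_2)+H(\theta_1,\phi_1)\ge0$ for any rectangle $[\theta_1,\theta_2]\times[\phi_1,\phi_2]$ in $\mathbf C^2$, $H(\theta,0)=H(0,\phi)=0$, and $\lim_{\theta\nearrow2\pi}\lim_{\phi\nearrow2\pi}H(\theta,\phi)=1$. Below, $F$ and $G$ denote the marginal circular distribution functions of $H$ in $\theta$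 and $\phi$ respectively. Extension of $F$ to $[0,4\pi)$: $\tilde F(\theta)=F(\theta)$ for $0\le\theta<2\pi$ and $\tilde F(\theta)=F(\theta-2\pi)+1$ for $2\pi\le\theta<4\pi$; similarly $\tilde G$. Changing the zero direction to $\alpha\in\mathbf C$ gives $F_\alpha(\theta)=\tilde F(\theta+\alpha)-\tilde F(\alpha)$; similarly $G_\beta(\phi)=\tilde G(\phi+\beta)-\tilde G(\beta)$ for $\beta\in\mathbf C$. Extension of $H$ to $[0,4\pi)^2$: $$\tilde H(\theta,\phi)=\begin{cases}H(\theta,\phi) & 0\le\theta<2\pi,\ 0\le\phi<2\pi,\\ F(\theta)+H(\theta,\phi-2\pi) & 0\le\theta<2\pi,\ 2\pi\le\phi<4\pi,\\ G(\phi)+H(\theta-2\pi,\phi) & 2\pi\le\theta<4\pi,\ 0\le\phi<2\pi,\\ 1+F(\theta-2\pi)+G(\phi-2\pi)+H(\theta-2\pi,\phi-2\pi) & 2\pi\le\theta<4\pi,\ 2\pi\le\phi<4\pi.\end{cases}$$ Changing the zero directions to $(\alpha,\beta)\in\mathbf C^2$ gives $$H_{\alpha,\beta}(\theta,\phi)=\tilde H(\theta+\alpha,\phi+\beta)-\tilde H(\alpha,\phi+\beta)-\tilde H(\theta+\alpha,\beta)+\tilde H(\alpha,\beta).$$ The circular copula function with zero directions $(\alpha,\beta)$ is $C_{\alpha,\beta}(u,v)=H_{\alpha,\beta}(F_\alpha^{(-1)}(u),G_\beta^{(-1)}(v))$, where $F_\alpha^{(-1)}$ and $G_\beta^{(-1)}$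 are the quasi-inverses of $F_\alpha$ and $G_\beta$. Since the choice of zero directions is arbitrary, the equivalence class of circular copula functions is defined as $\{C_{\alpha,\beta} : (\alpha,\beta)\in\mathbf C^2\}$.
   Formalization: F and G are assumed continuous on [0,2π); the claim fails for every discontinuous F or G (e.g. F=G=0 on [0,π), 1 on [π,2π) gives C_{0,0}=1 for all u,v>0). The quasi-inverse takes the infimum of the empty set to be 2π, which is otherwise undefined. *)

theory Defs
  imports "HOL-Analysis.Analysis"
begin

text \<open>
  Functions with domain \<open>[0, 2\<pi>)\<close> or \<open>[0, 2\<pi>)\<^sup>2\<close> are total functions on the reals of which only
  the values on that domain are ever used.
\<close>

definition circ :: "real set" where
  "circ = {0..<2 * pi}"

definition circular_df :: "(real \<Rightarrow> real) \<Rightarrow> bool" where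
  "circular_df F \<longleftrightarrow> mono_on circ F \<and> F 0 = 0 \<and> (F \<longlongrightarrow> 1) (at_left (2 * pi))"

text \<open>
  The infimum is taken in \<open>[0, 2\<pi>]\<close>, so the infimum of the empty set is \<open>2\<pi>\<close>. This matters for
  \<open>u = 1\<close> only: a circular distribution function tends to 1 at \<open>2\<pi>\<close> but need not attain 1 on
  \<open>[0, 2\<pi>)\<close>.
\<close>

definition quasi_inverse :: "(real \<Rightarrow> real) \<Rightarrow> real \<Rightarrow> real" where
  "quasi_inverse F u =
     (if \<exists>\<theta>\<in>circ. F \<theta> \<ge> u then Inf {\<theta> \<in> circ. F \<theta> \<ge> u} else 2 * pi)"

text \<open>The function \<open>L\<close> is the inner limit in \<open>lim\<^sub>\<theta> lim\<^sub>\<phi> H \<theta> \<phi> = 1\<close>.\<close>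

definition circular_joint_df :: "(real \<Rightarrow> real \<Rightarrow> real) \<Rightarrow> bool" where
  "circular_joint_df H \<longleftrightarrow>
     (\<forall>\<theta>1\<in>circ. \<forall>\<theta>2\<in>circ. \<forall>\<phi>1\<in>circ. \<forall>\<phi>2\<in>circ. \<theta>1 \<le> \<theta>2 \<longrightarrow> \<phi>1 \<le> \<phi>2 \<longrightarrow>
        H \<theta>2 \<phi>2 - H \<theta>2 \<phi>1 - H \<theta>1 \<phi>2 + H \<theta>1 \<phi>1 \<ge> 0) \<and>
     (\<forall>\<theta>\<in>circ. H \<theta> 0 = 0) \<and> (\<forall>\<phi>\<in>circ. H 0 \<phi> = 0) \<and>
     (\<exists>L. (\<forall>\<theta>\<in>circ. (H \<theta> \<longlongrightarrow> L \<theta>) (at_left (2 * pi))) \<and> (L \<longlongrightarrow> 1) (at_left (2 * pi)))"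

definition marginal_fst :: "(real \<Rightarrow> real \<Rightarrow> real) \<Rightarrow> real \<Rightarrow> real" where
  "marginal_fst H \<theta> = Lim (at_left (2 * pi)) (\<lambda>\<phi>. H \<theta> \<phi>)"

definition marginal_snd :: "(real \<Rightarrow> real \<Rightarrow> real) \<Rightarrow> real \<Rightarrow> real" where
  "marginal_snd H \<phi> = Lim (at_left (2 * pi)) (\<lambda>\<theta>. H \<theta> \<phi>)"

text \<open>The extensions below are meant for arguments in \<open>[0, 4\<pi>)\<close> only.\<close>

definition ext_df :: "(real \<Rightarrow> real) \<Rightarrow> real \<Rightarrow> real" where
  "ext_df F \<theta> = (if \<theta> < 2 * pi then F \<theta> else F (\<theta> - 2 * pi) + 1)"

definition shift_df :: "(real \<Rightarrow> real) \<Rightarrow> real \<Rightarrow> real \<Rightarrow> real" where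
  "shift_df F \<alpha> \<theta> = ext_df F (\<theta> + \<alpha>) - ext_df F \<alpha>"

definition ext_joint :: "(real \<Rightarrow> real \<Rightarrow> real) \<Rightarrow> real \<Rightarrow> real \<Rightarrow> real" where
  "ext_joint H \<theta> \<phi> =
     (let F = marginal_fst H; G = marginal_snd H in
      if \<theta> < 2 * pi \<and> \<phi> < 2 * pi then H \<theta> \<phi>
      else if \<theta> < 2 * pi then F \<theta> + H \<theta> (\<phi> - 2 * pi)
      else if \<phi> < 2 * pi then G \<phi> + H (\<theta> - 2 * pi) \<phi>
      else 1 + F (\<theta> - 2 * pi) + G (\<phi> - 2 * pi) + H (\<theta> - 2 * pi) (\<phi> - 2 * pi))"

definition shift_joint :: "(real \<Rightarrow> real \<Rightarrow> real) \<Rightarrow> real \<Rightarrow> real \<Rightarrow> real \<Rightarrow> real \<Rightarrow> real" where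
  "shift_joint H \<alpha> \<beta> \<theta> \<phi> =
     ext_joint H (\<theta> + \<alpha>) (\<phi> + \<beta>) - ext_joint H \<alpha> (\<phi> + \<beta>)
     - ext_joint H (\<theta> + \<alpha>) \<beta> + ext_joint H \<alpha> \<beta>"

text \<open>
  Copula functions have domain \<open>[0, 1]\<^sup>2\<close>; they are made extensional by \<^const>\<open>restrict\<close> so that
  equality of functions is equality on \<open>[0, 1]\<^sup>2\<close>.
\<close>

definition circular_copula ::
    "(real \<Rightarrow> real \<Rightarrow> real) \<Rightarrow> real \<Rightarrow> real \<Rightarrow> real \<times> real \<Rightarrow> real" where
  "circular_copula H \<alpha> \<beta> =
     (\<lambda>(u, v)\<in>{0..1} \<times> {0..1}.
        shift_joint H \<alpha> \<beta>
          (quasi_inverse (shift_df (marginal_fst H) \<alpha>) u)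
          (quasi_inverse (shift_df (marginal_snd H) \<beta>) v))"

definition circular_copula_class ::
    "(real \<Rightarrow> real \<Rightarrow> real) \<Rightarrow> (real \<times> real \<Rightarrow> real) set" where
  "circular_copula_class H = {circular_copula H \<alpha> \<beta> | \<alpha> \<beta>. \<alpha> \<in> circ \<and> \<beta> \<in> circ}"

definition frechet_lower :: "real \<Rightarrow> real \<Rightarrow> real" where
  "frechet_lower u v = max (u + v - 1) 0"

definition circular_frechet_lower :: "real \<Rightarrow> real \<times> real \<Rightarrow> real" where
  "circular_frechet_lower a =
     (\<lambda>(u, v)\<in>{0..1} \<times> {0..1}.
        if (u, v) \<in> {0..a} \<times> {0..a} then max (u + v - a) 0
        else if (u, v) \<in> {a..1} \<times> {a..1} then max (u + v - 1) a
        else min u v)"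

text \<open>
  The Frechet-Hoeffding lower bound of two circular distribution functions is a circular joint
  distribution function with these margins, so the limits in \<^const>\<open>marginal_fst\<close> and
  \<^const>\<open>marginal_snd\<close> exist.
\<close>

lemma circular_df_bounds:
  assumes "circular_df F" "\<theta> \<in> circ"
  shows "0 \<le> F \<theta>" "F \<theta> \<le> 1"
proof -
  have m: "mono_on circ F" and z: "F 0 = 0" and l: "(F \<longlongrightarrow> 1) (at_left (2 * pi))"
    using assms(1) by (auto simp: circular_df_def)
  show "0 \<le> F \<theta>"
    using mono_onD[OF m, of 0 \<theta>] assms(2) z by (auto simp: circ_def)
  have "eventually (\<lambda>x. x \<in> {\<theta><..<2 * pi}) (at_left (2 * pi))"
    using assms(2) by (intro eventually_at_left_real) (auto simp: circ_def)
  then have "eventually (\<lambda>x. F \<theta> \<le> F x) (at_left (2 * pi))"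
    by eventually_elim (use assms(2) in \<open>auto intro!: mono_onD[OF m] simp: circ_def\<close>)
  then show "F \<theta> \<le> 1"
    by (rule tendsto_lowerbound[OF l]) (simp add: trivial_limit_at_left_real)
qed

lemma frechet_lower_tendsto:
  assumes "circular_df F" "circular_df G" "\<theta> \<in> circ"
  shows "((\<lambda>\<phi>. frechet_lower (F \<theta>) (G \<phi>)) \<longlongrightarrow> F \<theta>) (at_left (2 * pi))"
    and "((\<lambda>\<phi>. frechet_lower (G \<phi>) (F \<theta>)) \<longlongrightarrow> F \<theta>) (at_left (2 * pi))"
proof -
  have l: "(G \<longlongrightarrow> 1) (at_left (2 * pi))"
    using assms(2) by (simp add: circular_df_def)
  have "((\<lambda>\<phi>. frechet_lower (F \<theta>) (G \<phi>)) \<longlongrightarrow> max (F \<theta> + 1 - 1) 0) (at_left (2 * pi))"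
    unfolding frechet_lower_def by (intro tendsto_intros l)
  then show *: "((\<lambda>\<phi>. frechet_lower (F \<theta>) (G \<phi>)) \<longlongrightarrow> F \<theta>) (at_left (2 * pi))"
    using circular_df_bounds[OF assms(1,3)] by (simp add: max_def)
  then show "((\<lambda>\<phi>. frechet_lower (G \<phi>) (F \<theta>)) \<longlongrightarrow> F \<theta>) (at_left (2 * pi))"
    by (simp add: frechet_lower_def add.commute)
qed

lemma marginals_frechet_lower:
  assumes "circular_df F" "circular_df G" "\<theta> \<in> circ"
  shows "marginal_fst (\<lambda>\<theta> \<phi>. frechet_lower (F \<theta>) (G \<phi>)) \<theta> = F \<theta>"
    and "marginal_snd (\<lambda>\<theta> \<phi>. frechet_lower (F \<theta>) (G \<phi>)) \<theta> = G \<theta>"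
  unfolding marginal_fst_def marginal_snd_def
  using frechet_lower_tendsto[OF assms] frechet_lower_tendsto[OF assms(2,1,3)]
  by (auto intro!: tendsto_Lim simp: trivial_limit_at_left_real)

lemma circular_joint_df_frechet_lower:
  assumes "circular_df F" "circular_df G"
  shows "circular_joint_df (\<lambda>\<theta> \<phi>. frechet_lower (F \<theta>) (G \<phi>))"
proof -
  have F: "mono_on circ F" "F 0 = 0" "(F \<longlongrightarrow> 1) (at_left (2 * pi))"
    and G: "mono_on circ G" "G 0 = 0"
    using assms by (auto simp: circular_df_def)
  have "frechet_lower (F \<theta>2) (G \<phi>2) - frechet_lower (F \<theta>2) (G \<phi>1)
      - frechet_lower (F \<theta>1) (G \<phi>2) + frechet_lower (F \<theta>1) (G \<phi>1) \<ge> 0"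
    if "\<theta>1 \<in> circ" "\<theta>2 \<in> circ" "\<phi>1 \<in> circ" "\<phi>2 \<in> circ" "\<theta>1 \<le> \<theta>2" "\<phi>1 \<le> \<phi>2"
    for \<theta>1 \<theta>2 \<phi>1 \<phi>2
    using mono_onD[OF F(1) that(1,2,5)] mono_onD[OF G(1) that(3,4,6)]
    by (auto simp: frechet_lower_def max_def)
  moreover have "\<exists>L. (\<forall>\<theta>\<in>circ. ((\<lambda>\<phi>. frechet_lower (F \<theta>) (G \<phi>)) \<longlongrightarrow> L \<theta>) (at_left (2 * pi))) \<and>
      (L \<longlongrightarrow> 1) (at_left (2 * pi))"
    using frechet_lower_tendsto(1)[OF assms] F(3) by blast
  ultimately show ?thesis
    using circular_df_bounds[OF assms(1)] circular_df_bounds[OF assms(2)] F(2) G(2)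
    by (auto simp: circular_joint_df_def frechet_lower_def)
qed

end

theory Submission imports Defs begin

text \<open>
  Put \<open>s = F \<theta>\<close> and \<open>t = G \<phi>\<close>, extended past \<open>2\<pi>\<close>. Then the extension of \<open>H\<close> is a fixed
  function \<open>K s t\<close>, the mass in \<open>[0, s] \<times> [0, t]\<close> of the antidiagonals of the four unit squares of
  \<open>[0, 2]\<^sup>2\<close>. Since
  \<open>F\<close> and \<open>G\<close> are continuous, their quasi-inverses are right inverses, and \<open>C\<^sub>\<alpha>\<^sub>\<beta>\<close> is the mass that
  \<open>K\<close> gives to the rectangle \<open>[x, x + u] \<times> [y, y + v]\<close> with \<open>x = F \<alpha>\<close> and \<open>y = G \<beta>\<close>. Translated to the
  origin, the antidiagonals become \<open>u + v = a\<close> and \<open>u + v = 1 + a\<close> with \<open>a \<equiv> 1 - x - y\<close> modulo 1.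
\<close>

definition frechet_lower_ext :: "real \<Rightarrow> real \<Rightarrow> real" where
  "frechet_lower_ext s t =
     (if s \<le> 1 \<and> t \<le> 1 then max (s + t - 1) 0
      else if s \<le> 1 then s + max (s + t - 2) 0
      else if t \<le> 1 then t + max (s + t - 2) 0
      else s + t - 1 + max (s + t - 3) 0)"

lemma ext_df_eq_on:
  assumes "\<And>\<theta>. \<theta> \<in> circ \<Longrightarrow> F \<theta> = G \<theta>" "\<theta> \<in> {0..<4 * pi}"
  shows "ext_df F \<theta> = ext_df G \<theta>"
  using assms by (auto simp: ext_df_def circ_def)

lemma quasi_inverse_eq:
  assumes "\<And>\<theta>. \<theta> \<in> circ \<Longrightarrow> F \<theta> = G \<theta>"
  shows "quasi_inverse F u = quasi_inverse G u"
proof -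
  have "{\<theta> \<in> circ. F \<theta> \<ge> u} = {\<theta> \<in> circ. G \<theta> \<ge> u}"
    using assms by auto
  then show ?thesis
    using assms by (simp add: quasi_inverse_def)
qed

text \<open>The two pieces glue at \<open>2 * pi\<close> because the left limit 1 of
  \<open>F\<close> equals \<open>F 0 + 1\<close>. The interval is what a shift by
  \<open>\<alpha>\<close> sweeps out over one full turn.\<close>

lemma continuous_on_ext_df:
  assumes F: "circular_df F" "continuous_on circ F" and \<alpha>: "\<alpha> \<in> circ"
  shows "continuous_on {0..2 * pi + \<alpha>} (ext_df F)"
proof -
  have lim: "(F \<longlongrightarrow> 1) (at_left (2 * pi))" and F0: "F 0 = 0"
    using F(1) by (auto simp: circular_df_def)
  have left: "continuous_on {0..2 * pi} (ext_df F)"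
    unfolding continuous_on_def
  proof
    fix x assume x: "x \<in> {0..2 * pi}"
    show "(ext_df F \<longlongrightarrow> ext_df F x) (at x within {0..2 * pi})"
    proof (cases "x = 2 * pi")
      case True
      have "((\<lambda>\<theta>. F \<theta>) \<longlongrightarrow> 1) (at (2 * pi) within {0..2 * pi})"
        using lim by (simp add: at_within_Icc_at_left)
      \<comment> \<open>The filter leaves out the point \<open>2 * pi\<close> itself, where
        \<open>F\<close> has no meaningful value.\<close>
      moreover have "eventually (\<lambda>\<theta>. F \<theta> = ext_df F \<theta>) (at (2 * pi) within {0..2 * pi})"
        unfolding eventually_at_filter by (rule always_eventually) (simp add: ext_df_def)
      ultimately have "(ext_df F \<longlongrightarrow> 1) (at (2 * pi) within {0..2 * pi})"
        by (rule Lim_transform_eventually)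
      then show ?thesis
        using True F0 by (simp add: ext_df_def)
    next
      case False
      with x have xc: "x \<in> circ" by (auto simp: circ_def)
      have "(F \<longlongrightarrow> F x) (at x within circ)"
        using F(2) xc by (auto simp: continuous_on_def)
      moreover have "at x within circ = at x within {0..2 * pi}"
        by (rule at_within_nhd[of _ "{..<2 * pi}"]) (use xc in \<open>auto simp: circ_def\<close>)
      ultimately have "(F \<longlongrightarrow> F x) (at x within {0..2 * pi})" by simp
      moreover have "eventually (\<lambda>\<theta>. \<theta> < 2 * pi) (at x within {0..2 * pi})"
        using xc by (intro order_tendstoD(2)[OF tendsto_ident_at]) (auto simp: circ_def)
      then have "eventually (\<lambda>\<theta>. F \<theta> = ext_df F \<theta>) (at x within {0..2 * pi})"
        by eventually_elim (simp add: ext_df_def)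
      ultimately have "(ext_df F \<longlongrightarrow> F x) (at x within {0..2 * pi})"
        by (rule Lim_transform_eventually)
      then show ?thesis
        using xc by (simp add: ext_df_def circ_def)
    qed
  qed
  have "continuous_on {2 * pi..2 * pi + \<alpha>} (\<lambda>\<theta>. F (\<theta> - 2 * pi) + 1)"
    using \<alpha> by (intro continuous_intros continuous_on_compose2[OF F(2)]) (auto simp: circ_def)
  then have "continuous_on {2 * pi..2 * pi + \<alpha>} (ext_df F)"
    by (rule continuous_on_eq) (auto simp: ext_df_def)
  with left have "continuous_on ({0..2 * pi} \<union> {2 * pi..2 * pi + \<alpha>}) (ext_df F)"
    by (intro continuous_on_closed_Un) auto
  also have "{0..2 * pi} \<union> {2 * pi..2 * pi + \<alpha>} = {0..2 * pi + \<alpha>}"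
    using \<alpha> by (auto simp: circ_def)
  finally show ?thesis .
qed

text \<open>The intermediate value theorem needs a closed interval, so it is applied to
  \<open>ext_df F\<close>, which takes the value 1 at \<open>2 * pi\<close>. Since
  \<open>x < 1\<close>, the point found is not that endpoint.\<close>

lemma circular_df_surj:
  assumes F: "circular_df F" "continuous_on circ F" and x: "0 \<le> x" "x < 1"
  obtains \<alpha> where "\<alpha> \<in> circ" "F \<alpha> = x"
proof -
  have F0: "F 0 = 0" using F(1) by (simp add: circular_df_def)
  have "continuous_on {0..2 * pi} (ext_df F)"
    using continuous_on_ext_df[OF F, of 0] by (simp add: circ_def)
  then obtain \<alpha> where "0 \<le> \<alpha>" "\<alpha> \<le> 2 * pi" "ext_df F \<alpha> = x"
    using IVT'[of "ext_df F" 0 x "2 * pi"] x F0 by (auto simp: ext_df_def)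
  with x F0 that[of \<alpha>] show thesis
    by (cases "\<alpha> = 2 * pi") (auto simp: ext_df_def circ_def)
qed

text \<open>By continuity the infimum \<open>q\<close> satisfies \<open>f q \<ge> u\<close>. A point
  \<open>r \<le> q\<close> with \<open>f r = u\<close> belongs to the same superlevel set, which
  forces \<open>r = q\<close>.\<close>

lemma quasi_inverse_right_inverse:
  assumes f: "continuous_on {0..2 * pi} f" "f 0 = 0" "f (2 * pi) = 1" and u: "u \<in> {0..1}"
  shows "quasi_inverse f u \<in> {0..2 * pi}" "f (quasi_inverse f u) = u"
proof -
  have "quasi_inverse f u \<in> {0..2 * pi} \<and> f (quasi_inverse f u) = u"
  proof (cases "\<exists>\<theta>\<in>circ. f \<theta> \<ge> u")
    case True
    define S where "S = {\<theta> \<in> circ. f \<theta> \<ge> u}"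
    define q where "q = Inf S"
    have q: "quasi_inverse f u = q"
      using True by (simp add: quasi_inverse_def q_def S_def)
    have S: "S \<noteq> {}" "bdd_below S"
      using True by (auto simp: S_def circ_def bdd_below_def)
    have "closed ({0..2 * pi} \<inter> f -` {u..})"
      using f(1) by (rule continuous_closed_preimage) auto
    then have "closure S \<subseteq> {0..2 * pi} \<inter> f -` {u..}"
      by (intro closure_minimal) (auto simp: S_def circ_def)
    moreover have "q \<in> closure S"
      unfolding q_def by (rule closure_contains_Inf[OF S])
    ultimately have qb: "q \<in> {0..2 * pi}" "f q \<ge> u" by auto
    obtain \<theta> where "\<theta> \<in> S" using S by auto
    then have "q < 2 * pi"
      using cInf_lower[OF \<open>\<theta> \<in> S\<close> S(2)] by (auto simp: q_def S_def circ_def)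
    obtain r where r: "0 \<le> r" "r \<le> q" "f r = u"
      using IVT'[of f 0 u q] qb u f(2) continuous_on_subset[OF f(1), of "{0..q}"] by auto
    with \<open>q < 2 * pi\<close> have "r \<in> S" by (auto simp: S_def circ_def)
    then have "q \<le> r" unfolding q_def by (rule cInf_lower[OF _ S(2)])
    with r qb q show ?thesis by auto
  next
    case False
    \<comment> \<open>Here \<open>u\<close> is attained at \<open>2 * pi\<close> only, which is
      exactly the default value of \<open>quasi_inverse\<close>.\<close>
    obtain r where "0 \<le> r" "r \<le> 2 * pi" "f r = u"
      using IVT'[of f 0 u "2 * pi"] u f by auto
    with False have "r = 2 * pi" by (force simp: circ_def)
    with \<open>f r = u\<close> False show ?thesis by (simp add: quasi_inverse_def)
  qed
  then show "quasi_inverse f u \<in> {0..2 * pi}" "f (quasi_inverse f u) = u" by auto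
qed

text \<open>\<open>M\<close> stands for a marginal of \<open>H\<close>, which is known to agree with
  \<open>F\<close> on \<open>circ\<close> only. The shifted function rises continuously from 0 to 1
  over one full turn, so its quasi-inverse is a right inverse.\<close>

lemma ext_df_quasi_inverse_shift:
  assumes F: "circular_df F" "continuous_on circ F" and \<alpha>: "\<alpha> \<in> circ" and u: "u \<in> {0..1}"
    and M: "\<And>\<theta>. \<theta> \<in> circ \<Longrightarrow> M \<theta> = F \<theta>"
  defines "q \<equiv> quasi_inverse (shift_df M \<alpha>) u"
  shows "q + \<alpha> \<in> {0..<4 * pi}" "ext_df F (q + \<alpha>) = F \<alpha> + u"
proof -
  have a: "0 \<le> \<alpha>" "\<alpha> < 2 * pi" using \<alpha> by (auto simp: circ_def)
  have "shift_df M \<alpha> \<theta> = shift_df F \<alpha> \<theta>" if "\<theta> \<in> circ" for \<theta>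
    using that a by (auto simp: shift_df_def circ_def intro!: arg_cong2[of _ _ _ _ minus] ext_df_eq_on M)
  then have q: "q = quasi_inverse (shift_df F \<alpha>) u"
    unfolding q_def by (rule quasi_inverse_eq)
  have "continuous_on {0..2 * pi} (shift_df F \<alpha>)"
    unfolding shift_df_def
    by (intro continuous_intros continuous_on_compose2[OF continuous_on_ext_df[OF F \<alpha>]])
      (use a in auto)
  moreover have "shift_df F \<alpha> 0 = 0" "shift_df F \<alpha> (2 * pi) = 1"
    using a by (auto simp: shift_df_def ext_df_def)
  ultimately have *: "q \<in> {0..2 * pi}" "shift_df F \<alpha> q = u"
    unfolding q using quasi_inverse_right_inverse u by blast+
  show "q + \<alpha> \<in> {0..<4 * pi}"
    using a *(1) by simp
  have "ext_df F \<alpha> = F \<alpha>"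
    using a by (simp add: ext_df_def)
  then show "ext_df F (q + \<alpha>) = F \<alpha> + u"
    using *(2) by (simp add: shift_df_def)
qed

text \<open>\<open>ext_joint\<close> branches on angles, \<open>frechet_lower_ext\<close> on values.
  The choices can differ only where a value equals 1, and there the adjacent formulas agree.\<close>

lemma ext_joint_frechet_lower:
  assumes F: "circular_df F" and G: "circular_df G"
    and \<theta>: "\<theta> \<in> {0..<4 * pi}" and \<phi>: "\<phi> \<in> {0..<4 * pi}"
  shows "ext_joint (\<lambda>\<theta> \<phi>. frechet_lower (F \<theta>) (G \<phi>)) \<theta> \<phi>
    = frechet_lower_ext (ext_df F \<theta>) (ext_df G \<phi>)"
proof -
  \<comment> \<open>Reducing the angles modulo \<open>2 * pi\<close> brings them into
    \<open>circ\<close>, where the bounds and the marginals are known.\<close>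
  define x where "x = (if \<theta> < 2 * pi then \<theta> else \<theta> - 2 * pi)"
  define y where "y = (if \<phi> < 2 * pi then \<phi> else \<phi> - 2 * pi)"
  have xy: "x \<in> circ" "y \<in> circ"
    using \<theta> \<phi> by (auto simp: x_def y_def circ_def)
  note b = circular_df_bounds[OF F xy(1)] circular_df_bounds[OF G xy(2)]
  note m = marginals_frechet_lower(1)[OF F G xy(1)] marginals_frechet_lower(2)[OF F G xy(2)]
  show ?thesis
    using b m unfolding x_def y_def
    by (cases "\<theta> < 2 * pi"; cases "\<phi> < 2 * pi")
      (simp_all add: ext_joint_def Let_def frechet_lower_ext_def ext_df_def frechet_lower_def)
qed

text \<open>\<open>a\<close> is a representative in [0, 1] of \<open>1 - x - y\<close> modulo 1.
  Both sides are piecewise linear, so finitely many cases of linear arithmetic suffice.\<close>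

lemma frechet_lower_ext_rectangle:
  assumes "x \<in> {0..1}" "y \<in> {0..1}" "u \<in> {0..1}" "v \<in> {0..1}"
    and a: "a = (if x + y \<le> 1 then 1 - x - y else 2 - x - y)"
  shows "frechet_lower_ext (x + u) (y + v) - frechet_lower_ext x (y + v)
      - frechet_lower_ext (x + u) y + frechet_lower_ext x y = circular_frechet_lower a (u, v)"
proof -
  have bounds: "0 \<le> x" "x \<le> 1" "0 \<le> y" "y \<le> 1" "0 \<le> u" "u \<le> 1" "0 \<le> v" "v \<le> 1"
    using assms by auto
  have W: "circular_frechet_lower a (u, v) =
      (if u \<le> a \<and> v \<le> a then max (u + v - a) 0
       else if a \<le> u \<and> a \<le> v then max (u + v - 1) a else min u v)"
    using bounds by (simp add: circular_frechet_lower_def)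
  show ?thesis
    using bounds a unfolding W frechet_lower_ext_def max_def min_def
    \<comment> \<open>The three splits fix the branches of all four \<open>frechet_lower_ext\<close>
      terms and of \<open>a\<close>.\<close>
    by (cases "x + u \<le> 1"; cases "y + v \<le> 1"; cases "x + y \<le> 1"; simp; smt (verit))
qed

text \<open>The zero directions enter only through \<open>F \<alpha>\<close> and
  \<open>G \<beta>\<close>, the lower left corner of the rectangle whose mass is computed.\<close>

lemma circular_copula_frechet_lower:
  assumes F: "circular_df F" "continuous_on circ F" and G: "circular_df G" "continuous_on circ G"
    and \<alpha>: "\<alpha> \<in> circ" and \<beta>: "\<beta> \<in> circ"
    and a: "a = (if F \<alpha> + G \<beta> \<le> 1 then 1 - F \<alpha> - G \<beta> else 2 - F \<alpha> - G \<beta>)"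
  shows "circular_copula (\<lambda>\<theta> \<phi>. frechet_lower (F \<theta>) (G \<phi>)) \<alpha> \<beta> = circular_frechet_lower a"
proof
  fix p :: "real \<times> real"
  let ?H = "\<lambda>\<theta> \<phi>. frechet_lower (F \<theta>) (G \<phi>)"
  obtain u v where p: "p = (u, v)" by fastforce
  show "circular_copula ?H \<alpha> \<beta> p = circular_frechet_lower a p"
  proof (cases "p \<in> {0..1} \<times> {0..1}")
    case False
    then show ?thesis by (simp add: circular_copula_def circular_frechet_lower_def)
  next
    case True
    then have uv: "u \<in> {0..1}" "v \<in> {0..1}" by (auto simp: p)
    define q where "q = quasi_inverse (shift_df (marginal_fst ?H) \<alpha>) u"
    define r where "r = quasi_inverse (shift_df (marginal_snd ?H) \<beta>) v"
    have q: "q + \<alpha> \<in> {0..<4 * pi}" "ext_df F (q + \<alpha>) = F \<alpha> + u"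
      unfolding q_def using marginals_frechet_lower(1)[OF F(1) G(1)]
      by (intro ext_df_quasi_inverse_shift[OF F \<alpha> uv(1)]; simp)+
    have r: "r + \<beta> \<in> {0..<4 * pi}" "ext_df G (r + \<beta>) = G \<beta> + v"
      unfolding r_def using marginals_frechet_lower(2)[OF F(1) G(1)]
      by (intro ext_df_quasi_inverse_shift[OF G \<beta> uv(2)]; simp)+
    have \<alpha>\<beta>: "\<alpha> \<in> {0..<4 * pi}" "ext_df F \<alpha> = F \<alpha>" "\<beta> \<in> {0..<4 * pi}" "ext_df G \<beta> = G \<beta>"
      using \<alpha> \<beta> by (auto simp: circ_def ext_df_def)
    have "circular_copula ?H \<alpha> \<beta> p = shift_joint ?H \<alpha> \<beta> q r"
      using uv by (simp add: circular_copula_def p q_def r_def)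
    also have "\<dots> = frechet_lower_ext (F \<alpha> + u) (G \<beta> + v) - frechet_lower_ext (F \<alpha>) (G \<beta> + v)
        - frechet_lower_ext (F \<alpha> + u) (G \<beta>) + frechet_lower_ext (F \<alpha>) (G \<beta>)"
      \<comment> \<open>The interval memberships stay folded so that the recorded facts discharge
        the premises of the rewrite rule.\<close>
      by (simp add: shift_joint_def ext_joint_frechet_lower[OF F(1) G(1)] q r \<alpha>\<beta> del: atLeastLessThan_iff)
    also have "\<dots> = circular_frechet_lower a p"
      unfolding p by (rule frechet_lower_ext_rectangle)
        (use uv a circular_df_bounds[OF F(1) \<alpha>] circular_df_bounds[OF G(1) \<beta>] in auto)
    finally show ?thesis .
  qed
qed

theorem theorem2:
  fixes F G :: "real \<Rightarrow> real"
  assumes "circular_df F" and "circular_df G"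
    and "continuous_on circ F" and "continuous_on circ G"
  shows "circular_copula_class (\<lambda>\<theta> \<phi>. frechet_lower (F \<theta>) (G \<phi>)) =
           {circular_frechet_lower a | a. 0 \<le> a \<and> a \<le> 1}"
proof (intro equalityI subsetI)
  fix C assume "C \<in> circular_copula_class (\<lambda>\<theta> \<phi>. frechet_lower (F \<theta>) (G \<phi>))"
  then obtain \<alpha> \<beta> where \<alpha>\<beta>: "\<alpha> \<in> circ" "\<beta> \<in> circ"
    and C: "C = circular_copula (\<lambda>\<theta> \<phi>. frechet_lower (F \<theta>) (G \<phi>)) \<alpha> \<beta>"
    by (auto simp: circular_copula_class_def)
  define a where "a = (if F \<alpha> + G \<beta> \<le> 1 then 1 - F \<alpha> - G \<beta> else 2 - F \<alpha> - G \<beta>)"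
  have "0 \<le> a" "a \<le> 1"
    using circular_df_bounds[OF assms(1) \<alpha>\<beta>(1)] circular_df_bounds[OF assms(2) \<alpha>\<beta>(2)]
    by (auto simp: a_def)
  moreover have "C = circular_frechet_lower a"
    unfolding C
    by (rule circular_copula_frechet_lower[OF assms(1,3) assms(2,4) \<alpha>\<beta> a_def])
  ultimately show "C \<in> {circular_frechet_lower a | a. 0 \<le> a \<and> a \<le> 1}" by blast
next
  fix C assume "C \<in> {circular_frechet_lower a | a. 0 \<le> a \<and> a \<le> 1}"
  then obtain a where a: "0 \<le> a" "a \<le> 1" and C: "C = circular_frechet_lower a" by blast
  \<comment> \<open>Splitting \<open>1 - a\<close> evenly keeps both values below 1, which \<open>F\<close> and \<open>G\<close> need not attain.\<close>
  obtain \<alpha> where \<alpha>: "\<alpha> \<in> circ" "F \<alpha> = (1 - a) / 2"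
    using circular_df_surj[OF assms(1,3), of "(1 - a) / 2"] a by auto
  obtain \<beta> where \<beta>: "\<beta> \<in> circ" "G \<beta> = (1 - a) / 2"
    using circular_df_surj[OF assms(2,4), of "(1 - a) / 2"] a by auto
  \<comment> \<open>The two values add up to \<open>1 - a \<le> 1\<close>, so the first branch of
    the parameter formula returns \<open>a\<close>.\<close>
  have "C = circular_copula (\<lambda>\<theta> \<phi>. frechet_lower (F \<theta>) (G \<phi>)) \<alpha> \<beta>"
    unfolding C
    by (rule circular_copula_frechet_lower[OF assms(1,3) assms(2,4) \<alpha>(1) \<beta>(1), symmetric])
      (use \<alpha> \<beta> a in \<open>auto simp: field_simps\<close>)
  with \<alpha> \<beta> show "C \<in> circular_copula_class (\<lambda>\<theta> \<phi>. frechet_lower (F \<theta>) (G \<phi>))"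
    by (auto simp: circular_copula_class_def)
qed

end
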